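(* Let $\mathcal{P}=(\mathcal{E},D,c,f_c)$ be a combinatorial sum problem, $E\subseteq\mathcal{E}$, and let $E_1,\dots,E_m$ be an arbitrary partition of $E$ (pairwise disjoint sets with $E=\bigcup_{i=1}^mE_i$). Then $l'_{\mathcal{P}}(E)\le\sum_{i=1}^m l'_{\mathcal{P}}(E_i)$.
   Context: A combinatorial sum problem (CSP) is a tuple $\mathcal{P}=(\mathcal{E},D,c,f_c)$, where $\mathcal{E}$ is a finite ground set, $D\subseteq 2^{\mathcal{E}}\setminus\{\emptyset\}$ is the set of feasible solutions, $c:\mathcal{E}\to\mathbb{R}$ and $f_c(S)=\sum_{e\in S}c(e)$ for $S\in D$; the optimal value is $c^\ast=\min_{S\in D}f_c(S)$. For $F=\{f_1,\dots,f_k\}\subseteq\mathcal{E}$ and $\vec\alpha=(\alpha_1,\dots,\alpha_k)\in\mathbb{R}^k$, $\mathcal{P}_{c_{-\vec\alpha,F}}$ is the CSP with cost of $f_i$ changed to $c(f_i)-\alpha_i$ and all other costs unchanged; $f_{c_{-\vec\alpha,F}}(\mathcal{P}_{c_{-\vec\alpha,F}})$ denotes its optimal value. The set lower tolerance is $l'_{\mathcal{P}}(F)=\max\{\alpha\in\mathbb{R}:$ there exists $\vec\alpha$ with all $\alpha_i\ge0$, $\alpha=\sum_i\alpha_i$, $f_{c_{-\vec\alpha,F}}(\mathcal{P}_{c_{-\vec\alpha,F}})=c^\ast\}$, with value $\infty$ if this set is unbounded. *)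

theory Defs
  imports Complex_Main "HOL-Library.Extended_Real" "HOL-Library.Disjoint_Sets"
begin

text \<open>Combinatorial sum problems. The cost is a total function on the element type; only its values
  on the ground set matter.\<close>

record 'e csp =
  ground :: "'e set"
  feasible :: "'e set set"
  cost :: "'e \<Rightarrow> real"

definition is_csp :: "'e csp \<Rightarrow> bool" where
  "is_csp P \<longleftrightarrow> finite (ground P) \<and> feasible P \<subseteq> Pow (ground P) - {{}}"

definition objective :: "'e csp \<Rightarrow> 'e set \<Rightarrow> real" where
  "objective P S = (\<Sum>e\<in>S. cost P e)"

text \<open>As with the minimum in the usual definition, \<open>opt_value P\<close> is only meaningful if some solution
  is feasible.\<close>

definition opt_value :: "'e csp \<Rightarrow> real" where
  "opt_value P = Min (objective P ` feasible P)"

text \<open>A vector \<open>(\<alpha>\<^sub>1, \<dots>, \<alpha>\<^sub>k)\<close> attached to \<open>F = {f\<^sub>1, \<dots>, f\<^sub>k}\<close> is represented by a function \<open>\<alpha>\<close>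
  whose value at \<open>f\<^sub>i\<close> is \<open>\<alpha>\<^sub>i\<close>; its values outside \<open>F\<close> are irrelevant.\<close>

definition lower_costs :: "'e csp \<Rightarrow> 'e set \<Rightarrow> ('e \<Rightarrow> real) \<Rightarrow> 'e csp" where
  "lower_costs P F \<alpha> = P\<lparr>cost := (\<lambda>e. if e \<in> F then cost P e - \<alpha> e else cost P e)\<rparr>"

definition admissible_decreases :: "'e csp \<Rightarrow> 'e set \<Rightarrow> real set" where
  "admissible_decreases P F =
     {a. \<exists>\<alpha>. (\<forall>f\<in>F. \<alpha> f \<ge> 0) \<and> a = (\<Sum>f\<in>F. \<alpha> f) \<and> opt_value (lower_costs P F \<alpha>) = opt_value P}"

text \<open>In the bounded case the maximum is attained: the admissible vectors then form a nonempty
  compact set.\<close>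

definition set_lower_tolerance :: "'e csp \<Rightarrow> 'e set \<Rightarrow> ereal" where
  "set_lower_tolerance P F =
     (if bdd_above (admissible_decreases P F)
      then ereal (GREATEST a. a \<in> admissible_decreases P F)
      else \<infinity>)"

end

theory Submission imports Defs "HOL-Analysis.Function_Topology" begin

text \<open>Lowering costs by a nonnegative vector \<open>\<alpha>\<close> keeps the optimal value iff no solution drops
  below \<open>c\<^sup>*\<close>, and this condition is inherited by restrictions of \<open>\<alpha>\<close>. So every decrease
  admissible for \<open>E\<close> is a sum of decreases admissible for the \<open>E\<^sub>i\<close>. Moreover the condition is a
  finite system of weak linear inequalities, so by compactness the tolerance is the supremum of
  the admissible decreases, and the inequality follows by taking suprema.\<close>

lemma objective_lower_costs:
  assumes "finite S"
  shows "objective (lower_costs P F \<alpha>) S = objective P S - sum \<alpha> (S \<inter> F)"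
proof -
  have "objective (lower_costs P F \<alpha>) S = (\<Sum>e\<in>S. cost P e - (if e \<in> F then \<alpha> e else 0))"
    unfolding objective_def lower_costs_def by (auto intro!: sum.cong)
  also have "\<dots> = objective P S - sum \<alpha> (S \<inter> F)"
    using assms by (simp add: objective_def sum_subtractf sum.inter_restrict)
  finally show ?thesis .
qed

lemma feasible_lower_costs: "feasible (lower_costs P F \<alpha>) = feasible P"
  by (simp add: lower_costs_def)

lemma finite_feasible:
  assumes "is_csp P"
  shows "finite (feasible P)" and "S \<in> feasible P \<Longrightarrow> finite S"
  using assms finite_subset[of "feasible P" "Pow (ground P)"] finite_subset[of S "ground P"]
  by (auto simp: is_csp_def)

text \<open>Without feasible solutions both sides hold: both optimal values are then the same junk value
  \<open>Min {}\<close>.\<close>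

lemma opt_value_lower_costs_eq_iff:
  assumes P: "is_csp P" and nonneg: "\<forall>f\<in>F. \<alpha> f \<ge> 0"
  shows "opt_value (lower_costs P F \<alpha>) = opt_value P \<longleftrightarrow>
    (\<forall>S\<in>feasible P. opt_value P \<le> objective P S - sum \<alpha> (S \<inter> F))"
proof (cases "feasible P = {}")
  case True
  then show ?thesis by (simp add: opt_value_def feasible_lower_costs)
next
  case False
  let ?g = "\<lambda>S. objective P S - sum \<alpha> (S \<inter> F)"
  note fin = finite_feasible[OF P]
  have eq: "opt_value (lower_costs P F \<alpha>) = Min (?g ` feasible P)"
    unfolding opt_value_def
    using fin(2) by (intro arg_cong[of _ _ Min] image_cong)
      (simp_all add: objective_lower_costs feasible_lower_costs)
  have "opt_value P \<in> objective P ` feasible P"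
    unfolding opt_value_def using False fin(1) by (intro Min_in) auto
  then obtain T where T: "T \<in> feasible P" "opt_value P = objective P T" by blast
  \<comment> \<open>\<open>T\<close> is optimal for the original costs, and lowering costs can only
    make it cheaper. So the new minimum never exceeds \<open>opt_value P\<close>, and equality
    reduces to the reverse inequality.\<close>
  have "Min (?g ` feasible P) \<le> ?g T"
    using T fin(1) by simp
  also have "\<dots> \<le> opt_value P"
    using T nonneg by (auto intro!: sum_nonneg)
  finally have "Min (?g ` feasible P) \<le> opt_value P" .
  then have "Min (?g ` feasible P) = opt_value P \<longleftrightarrow> opt_value P \<le> Min (?g ` feasible P)"
    by auto
  also have "\<dots> \<longleftrightarrow> (\<forall>S\<in>feasible P. opt_value P \<le> ?g S)"
    using False fin(1) by (subst Min_ge_iff) auto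
  finally show ?thesis by (simp only: eq)
qed

lemma admissible_decreases_iff:
  assumes "is_csp P"
  shows "a \<in> admissible_decreases P F \<longleftrightarrow>
    (\<exists>\<alpha>. (\<forall>f\<in>F. \<alpha> f \<ge> 0) \<and> a = sum \<alpha> F \<and>
      (\<forall>S\<in>feasible P. opt_value P \<le> objective P S - sum \<alpha> (S \<inter> F)))"
  unfolding admissible_decreases_def
  using opt_value_lower_costs_eq_iff[OF assms, of F] by auto

lemma zero_in_admissible_decreases:
  "0 \<in> admissible_decreases P F"
proof -
  have "lower_costs P F (\<lambda>_. 0) = P"
    by (simp add: lower_costs_def cong: if_cong)
  then show ?thesis
    unfolding admissible_decreases_def by (force intro: exI[of _ "\<lambda>_. 0"])
qed

text \<open>A bound on the total decrease bounds every coordinate of a nonnegative vector, so the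
  admissible vectors, set to 0 off \<open>F\<close>, form a compact set, on which the continuous map
  \<open>sum \<alpha> F\<close> attains its maximum.\<close>

lemma admissible_decreases_attains_max:
  assumes P: "is_csp P" and F: "finite F" and bdd: "bdd_above (admissible_decreases P F)"
  obtains a where "a \<in> admissible_decreases P F" "\<And>b. b \<in> admissible_decreases P F \<Longrightarrow> b \<le> a"
proof -
  obtain B where B: "b \<le> B" if "b \<in> admissible_decreases P F" for b
    using bdd by (auto simp: bdd_above_def)
  \<comment> \<open>Values of \<alpha> off \<open>F\<close> are irrelevant but unbounded; pinning
    them to 0 makes the box compact.\<close>
  define K where "K = PiE UNIV (\<lambda>e. if e \<in> F then {0..B} else {0})"
  define A where "A = (\<Inter>S\<in>feasible P. {\<alpha>. opt_value P \<le> objective P S - sum \<alpha> (S \<inter> F)})"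
  have cont: "continuous_on X (\<lambda>\<alpha>. sum \<alpha> S)" for S and X :: "('a \<Rightarrow> real) set"
    by (intro continuous_intros continuous_on_product_then_coordinatewise continuous_on_id)
  \<comment> \<open>This is Tychonoff's theorem, so the element type may be infinite.\<close>
  have "compactin (product_topology (\<lambda>_. euclidean) UNIV) K"
    unfolding K_def by (subst compactin_PiE) auto
  then have "compact K"
    by (simp add: euclidean_product_topology)
  moreover have "closed A"
    unfolding A_def by (intro closed_INT ballI closed_Collect_le continuous_intros cont)
  ultimately have "compact (K \<inter> A)" by blast
  have in_KA: "\<exists>\<alpha>\<in>K \<inter> A. b = sum \<alpha> F" if "b \<in> admissible_decreases P F" for b
  proof -
    from that obtain \<alpha> where \<alpha>: "\<forall>f\<in>F. \<alpha> f \<ge> 0" "b = sum \<alpha> F"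
      "\<forall>S\<in>feasible P. opt_value P \<le> objective P S - sum \<alpha> (S \<inter> F)"
      unfolding admissible_decreases_iff[OF P] by blast
    define \<beta> where "\<beta> e = (if e \<in> F then \<alpha> e else 0)" for e
    have "sum \<beta> (S \<inter> F) = sum \<alpha> (S \<inter> F)" for S
      by (auto simp: \<beta>_def intro!: sum.cong)
    \<comment> \<open>The instance \<open>S = UNIV\<close> turns \<open>S \<inter> F\<close> into
      \<open>F\<close>.\<close>
    moreover from this[of UNIV] have "b = sum \<beta> F"
      using \<alpha>(2) by simp
    moreover have "\<alpha> f \<le> B" if "f \<in> F" for f
      using member_le_sum[OF that, of \<alpha>] \<alpha>(1,2) F B[OF \<open>b \<in> _\<close>] by auto
    ultimately show ?thesis
      using \<alpha>(1,3) by (intro bexI[of _ \<beta>]) (auto simp: K_def A_def \<beta>_def[abs_def])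
  qed
  have KA_in: "sum \<alpha> F \<in> admissible_decreases P F" if "\<alpha> \<in> K \<inter> A" for \<alpha>
  proof -
    have "\<alpha> f \<ge> 0" if "f \<in> F" for f
      using PiE_mem[of \<alpha> UNIV "\<lambda>e. if e \<in> F then {0..B} else {0}" f] \<open>\<alpha> \<in> K \<inter> A\<close> that
      by (simp add: K_def)
    then show ?thesis
      using that unfolding admissible_decreases_iff[OF P] A_def by blast
  qed
  have "K \<inter> A \<noteq> {}"
    using in_KA[OF zero_in_admissible_decreases] by blast
  then obtain \<alpha> where "\<alpha> \<in> K \<inter> A" "\<forall>\<beta>\<in>K \<inter> A. sum \<beta> F \<le> sum \<alpha> F"
    using continuous_attains_sup[OF \<open>compact (K \<inter> A)\<close> _ cont] by blast
  then show ?thesis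
    using that[OF KA_in] in_KA by metis
qed

text \<open>The supremum covers the bounded and the unbounded case at once, so later estimates need
  neither a case split nor \<open>GREATEST\<close>.\<close>

lemma set_lower_tolerance_eq_SUP:
  assumes "is_csp P" and "finite F"
  shows "set_lower_tolerance P F = (SUP a\<in>admissible_decreases P F. ereal a)"
proof (cases "bdd_above (admissible_decreases P F)")
  case True
  obtain a where a: "a \<in> admissible_decreases P F"
      "\<And>b. b \<in> admissible_decreases P F \<Longrightarrow> b \<le> a"
    using admissible_decreases_attains_max[OF assms True] by blast
  then have "(GREATEST a. a \<in> admissible_decreases P F) = a"
    by (intro Greatest_equality)
  moreover have "(SUP a\<in>admissible_decreases P F. ereal a) = ereal a"
    using a by (intro antisym SUP_least SUP_upper) auto
  ultimately show ?thesis
    using True by (simp add: set_lower_tolerance_def)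
next
  case False
  have "\<exists>a\<in>admissible_decreases P F. ereal (real n) \<le> ereal a" for n
    using False unfolding bdd_above_def by (metis ereal_less_eq(3) linorder_linear)
  then have "(SUP a\<in>admissible_decreases P F. ereal a) = \<infinity>"
    by (intro SUP_PInfty) auto
  then show ?thesis
    using False by (simp add: set_lower_tolerance_def)
qed

text \<open>Since \<alpha> is nonnegative, restricting it to \<open>G\<close> takes no more off any
  solution than \<alpha> did on \<open>F\<close>, so none can fall below the old optimum.\<close>

lemma sum_subset_in_admissible_decreases:
  assumes P: "is_csp P" and "G \<subseteq> F"
    and nonneg: "\<forall>f\<in>F. \<alpha> f \<ge> 0"
    and opt: "\<forall>S\<in>feasible P. opt_value P \<le> objective P S - sum \<alpha> (S \<inter> F)"
  shows "sum \<alpha> G \<in> admissible_decreases P G"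
proof -
  have "opt_value P \<le> objective P S - sum \<alpha> (S \<inter> G)" if "S \<in> feasible P" for S
  proof -
    have "sum \<alpha> (S \<inter> G) \<le> sum \<alpha> (S \<inter> F)"
      using finite_feasible(2)[OF P that] nonneg \<open>G \<subseteq> F\<close> by (intro sum_mono2) auto
    then show ?thesis using opt that by force
  qed
  then show ?thesis
    unfolding admissible_decreases_iff[OF P] using nonneg \<open>G \<subseteq> F\<close> by blast
qed

theorem theorem11:
  fixes P :: "'e csp" and E :: "'e set" and Es :: "nat \<Rightarrow> 'e set" and m :: nat
  assumes "is_csp P"
    and "E \<subseteq> ground P"
    and "disjoint_family_on Es {1..m}"
    and "E = (\<Union>i\<in>{1..m}. Es i)"
  shows "set_lower_tolerance P E \<le> (\<Sum>i=1..m. set_lower_tolerance P (Es i))"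
proof -
  have "finite E"
    using assms(1,2) by (auto simp: is_csp_def intro: finite_subset)
  have sub: "Es i \<subseteq> E" if "i \<in> {1..m}" for i
    using assms(4) that by blast
  have fin: "finite (Es i)" if "i \<in> {1..m}" for i
    using finite_subset[OF sub[OF that] \<open>finite E\<close>] .
  have "ereal a \<le> (\<Sum>i=1..m. set_lower_tolerance P (Es i))"
    if "a \<in> admissible_decreases P E" for a
  proof -
    from that obtain \<alpha> where \<alpha>: "\<forall>f\<in>E. \<alpha> f \<ge> 0" "a = sum \<alpha> E"
      "\<forall>S\<in>feasible P. opt_value P \<le> objective P S - sum \<alpha> (S \<inter> E)"
      unfolding admissible_decreases_iff[OF assms(1)] by blast
    \<comment> \<open>Disjointness is what lets the total decrease split over the blocks without
      counting an element twice.\<close>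
    have "a = (\<Sum>i=1..m. sum \<alpha> (Es i))"
      unfolding \<alpha>(2) assms(4) using fin assms(3)
      by (intro sum.UNION_disjoint) (auto simp: disjoint_family_on_def)
    then have "ereal a = (\<Sum>i=1..m. ereal (sum \<alpha> (Es i)))"
      by simp
    \<comment> \<open>One vector \<alpha> serves all blocks: its restriction to each
      \<open>Es i\<close> is admissible there, so the block sum lies below the supremum for that
      block.\<close>
    also have "\<dots> \<le> (\<Sum>i=1..m. set_lower_tolerance P (Es i))"
    proof (rule sum_mono)
      fix i assume i: "i \<in> {1..m}"
      show "ereal (sum \<alpha> (Es i)) \<le> set_lower_tolerance P (Es i)"
        unfolding set_lower_tolerance_eq_SUP[OF assms(1) fin[OF i]]
        by (intro SUP_upper sum_subset_in_admissible_decreases[OF assms(1) sub[OF i] \<alpha>(1,3)])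
    qed
    finally show ?thesis .
  qed
  then show ?thesis
    unfolding set_lower_tolerance_eq_SUP[OF assms(1) \<open>finite E\<close>] by (rule SUP_least)
qed

end
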